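(* Let $R$ be an associative ring with unity. Then $R$ is a weak nil clean ring if and only if there exists a central idempotent $e$ in $R$ such that the ideals $\langle e\rangle$ and $\langle 1-e\rangle$ generated by $e$ and $1-e$ are both weak nil clean ideals of $R$ and one of them is a nil clean ideal of $R$.
   Context: Ideals are two-sided. An ideal $I$ of $R$ is a weak nil clean ideal of $R$ if for every $x\in I$ there exist an idempotent $e\in R$ and a nilpotent $n\in R$ such that $x=e+n$ or $x=-e+n$. An ideal $I$ of $R$ is a nil clean ideal of $R$ if for every $x\in I$ there exist an idempotent $e\in R$ and a nilpotent $n\in R$ such that $x=e+n$. A ring $R$ is weak nil clean if every $x\in R$ can be written as $x=n+e$ or $x=n-e$ with $n\in R$ nilpotent and $e\in R$ idempotent. *)

theory Defs
  imports "HOL-Algebra.Ideal"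
begin

text \<open>The locale \<open>ring\<close> is that of associative, not necessarily commutative, rings with
  unity (the zero ring included), and its \<open>ideal\<close> is two-sided.\<close>

definition idempotent_elem :: "('a, 'b) ring_scheme \<Rightarrow> 'a \<Rightarrow> bool" where
  "idempotent_elem R e \<longleftrightarrow> e \<in> carrier R \<and> e \<otimes>\<^bsub>R\<^esub> e = e"

definition nilpotent_elem :: "('a, 'b) ring_scheme \<Rightarrow> 'a \<Rightarrow> bool" where
  "nilpotent_elem R n \<longleftrightarrow> n \<in> carrier R \<and> (\<exists>k::nat. k \<ge> 1 \<and> n [^]\<^bsub>R\<^esub> k = \<zero>\<^bsub>R\<^esub>)"

definition central_elem :: "('a, 'b) ring_scheme \<Rightarrow> 'a \<Rightarrow> bool" where
  "central_elem R c \<longleftrightarrow> c \<in> carrier R \<and> (\<forall>x \<in> carrier R. c \<otimes>\<^bsub>R\<^esub> x = x \<otimes>\<^bsub>R\<^esub> c)"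

text \<open>In the next two definitions the idempotent and the nilpotent are taken in the whole
  ring, not in the ideal.\<close>

definition nil_clean_ideal :: "'a set \<Rightarrow> ('a, 'b) ring_scheme \<Rightarrow> bool" where
  "nil_clean_ideal I R \<longleftrightarrow> ideal I R \<and>
     (\<forall>x \<in> I. \<exists>e n. idempotent_elem R e \<and> nilpotent_elem R n \<and> x = e \<oplus>\<^bsub>R\<^esub> n)"

definition weak_nil_clean_ideal :: "'a set \<Rightarrow> ('a, 'b) ring_scheme \<Rightarrow> bool" where
  "weak_nil_clean_ideal I R \<longleftrightarrow> ideal I R \<and>
     (\<forall>x \<in> I. \<exists>e n. idempotent_elem R e \<and> nilpotent_elem R n \<and>
        (x = e \<oplus>\<^bsub>R\<^esub> n \<or> x = (\<ominus>\<^bsub>R\<^esub> e) \<oplus>\<^bsub>R\<^esub> n))"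

definition weak_nil_clean_ring :: "('a, 'b) ring_scheme \<Rightarrow> bool" where
  "weak_nil_clean_ring R \<longleftrightarrow> ring R \<and>
     (\<forall>x \<in> carrier R. \<exists>n e. nilpotent_elem R n \<and> idempotent_elem R e \<and>
        (x = n \<oplus>\<^bsub>R\<^esub> e \<or> x = n \<ominus>\<^bsub>R\<^esub> e))"

end

theory Submission
  imports Defs
begin

text \<open>For the forward direction take \<open>e = 0\<close>. Conversely, a central idempotent \<open>e\<close> makes
  \<open>(a, b) \<mapsto> e a + (1 - e) b\<close> a ring homomorphism from \<open>R \<times> R\<close> onto \<open>R\<close>, which glues a
  decomposition of \<open>e x\<close> and one of \<open>(1 - e) x\<close> with the same sign to a decomposition of
  \<open>x\<close>. If \<open>\<langle>e\<rangle>\<close> is nil clean, the sign on \<open>e x\<close> can be prescribed, since \<open>- e x\<close> lies in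
  \<open>\<langle>e\<rangle>\<close> as well.\<close>

context ring
begin

text \<open>The arguments range over all of \<open>R\<close>, not over the corners
  \<open>e R\<close> and \<open>(1 - e) R\<close>, because the idempotents and nilpotents supplied
  by the ideals are only known to lie in \<open>R\<close>.\<close>

definition peirce_glue :: "'a \<Rightarrow> 'a \<Rightarrow> 'a \<Rightarrow> 'a" where
  "peirce_glue e a b = e \<otimes> a \<oplus> (\<one> \<ominus> e) \<otimes> b"

section \<open>Nilpotents and complementary central idempotents\<close>

lemma nilpotent_elem_uminus:
  assumes "nilpotent_elem R n"
  shows "nilpotent_elem R (\<ominus> n)"
proof -
  from assms obtain k :: nat where n: "n \<in> carrier R" and k: "k \<ge> 1" "n [^] k = \<zero>"
    unfolding nilpotent_elem_def by auto
  \<comment> \<open>Recording the sign only as a disjunction spares a parity argument; at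
    \<open>i = k\<close> both alternatives are zero.\<close>
  have "(\<ominus> n) [^] i = n [^] i \<or> (\<ominus> n) [^] i = \<ominus> (n [^] i)" for i :: nat
    by (induction i) (use n in \<open>auto simp: l_minus r_minus\<close>)
  from this[of k] k n show ?thesis
    unfolding nilpotent_elem_def by auto
qed

lemma nilpotent_elem_zero: "nilpotent_elem R \<zero>"
  unfolding nilpotent_elem_def by (auto intro!: exI[of _ "1::nat"])

lemma nat_pow_eq_zero_mono:
  assumes "x \<in> carrier R" "x [^] (k::nat) = \<zero>" "k \<le> l"
  shows "x [^] l = \<zero>"
  using assms nat_pow_mult[of x k "l - k"] by simp

lemma idempotent_elem_compl:
  assumes "idempotent_elem R e"
  shows "idempotent_elem R (\<one> \<ominus> e)"
  using assms unfolding idempotent_elem_def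
  by (auto simp: minus_eq l_distr r_distr l_minus r_minus a_assoc r_neg)

lemma central_elem_compl:
  assumes "central_elem R e"
  shows "central_elem R (\<one> \<ominus> e)"
  using assms unfolding central_elem_def
  by (auto simp: minus_eq l_distr r_distr l_minus r_minus)

lemma compl_compl:
  assumes "e \<in> carrier R"
  shows "\<one> \<ominus> (\<one> \<ominus> e) = e"
  using assms by (simp add: minus_eq minus_add r_neg2)

lemma mult_central_idempotent:
  assumes "idempotent_elem R e" "central_elem R e" "a \<in> carrier R" "b \<in> carrier R"
  shows "(e \<otimes> a) \<otimes> (e \<otimes> b) = e \<otimes> (a \<otimes> b)"
proof -
  have e: "e \<in> carrier R" "e \<otimes> e = e"
    using assms(1) unfolding idempotent_elem_def by auto
  have ae: "a \<otimes> e = e \<otimes> a"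
    using assms(2,3) unfolding central_elem_def by metis
  have "(e \<otimes> a) \<otimes> (e \<otimes> b) = e \<otimes> (a \<otimes> e) \<otimes> b"
    using e(1) assms(3,4) by (simp add: m_assoc)
  also have "\<dots> = (e \<otimes> e) \<otimes> a \<otimes> b"
    unfolding ae using e(1) assms(3,4) by (simp add: m_assoc)
  finally show ?thesis
    using e(1,2) assms(3,4) by (simp add: m_assoc)
qed

lemma mult_compl_eq_zero:
  assumes "idempotent_elem R e"
  shows "e \<otimes> (\<one> \<ominus> e) = \<zero>" "(\<one> \<ominus> e) \<otimes> e = \<zero>"
  using assms unfolding idempotent_elem_def
  by (auto simp: minus_eq l_distr r_distr l_minus r_minus r_neg)

text \<open>Centrality moves \<open>f\<close> past \<open>a\<close> until it meets \<open>e\<close>.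
  Used for \<open>e\<close> and \<open>1 - e\<close> in either order, this kills the cross terms of
  a product of two glued elements.\<close>

lemma mult_central_orthogonal:
  assumes "central_elem R f" "e \<in> carrier R" "e \<otimes> f = \<zero>" "a \<in> carrier R" "b \<in> carrier R"
  shows "(e \<otimes> a) \<otimes> (f \<otimes> b) = \<zero>"
proof -
  have f: "f \<in> carrier R" "a \<otimes> f = f \<otimes> a"
    using assms(1,4) unfolding central_elem_def by metis+
  have "(e \<otimes> a) \<otimes> (f \<otimes> b) = e \<otimes> (a \<otimes> f) \<otimes> b"
    using assms f(1) by (simp add: m_assoc)
  also have "\<dots> = (e \<otimes> f) \<otimes> a \<otimes> b"
    unfolding f(2) using assms(2,4,5) f(1) by (simp add: m_assoc)
  finally show ?thesis
    using assms by simp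
qed

section \<open>The glueing map as a ring homomorphism\<close>

lemma peirce_glue_closed:
  assumes "e \<in> carrier R" "a \<in> carrier R" "b \<in> carrier R"
  shows "peirce_glue e a b \<in> carrier R"
  using assms by (simp add: peirce_glue_def)

lemma peirce_glue_add:
  assumes "e \<in> carrier R" "a \<in> carrier R" "b \<in> carrier R" "c \<in> carrier R" "d \<in> carrier R"
  shows "peirce_glue e (a \<oplus> c) (b \<oplus> d) = peirce_glue e a b \<oplus> peirce_glue e c d"
proof -
  have "\<one> \<ominus> e \<in> carrier R" using assms by simp
  then show ?thesis
    using assms by (simp add: peirce_glue_def r_distr a_ac)
qed

lemma peirce_glue_uminus:
  assumes "e \<in> carrier R" "a \<in> carrier R" "b \<in> carrier R"
  shows "peirce_glue e (\<ominus> a) (\<ominus> b) = \<ominus> peirce_glue e a b"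
  using assms by (simp add: peirce_glue_def r_minus minus_add)

text \<open>Since \<open>e\<close> and \<open>1 - e\<close> sum to one, the map is the identity on
  the diagonal; in particular it preserves zero and one.\<close>

lemma peirce_glue_same:
  assumes "e \<in> carrier R" "a \<in> carrier R"
  shows "peirce_glue e a a = a"
  using assms by (simp add: peirce_glue_def minus_eq l_distr l_minus a_lcomm r_neg)

text \<open>The map multiplies by \<open>e\<close> and \<open>1 - e\<close> once more, which
  idempotence absorbs, so this reduces to the diagonal case.\<close>

lemma peirce_glue_components:
  assumes "idempotent_elem R e" "x \<in> carrier R"
  shows "peirce_glue e (e \<otimes> x) ((\<one> \<ominus> e) \<otimes> x) = x"
proof -
  have "e \<in> carrier R" "e \<otimes> e = e" "(\<one> \<ominus> e) \<otimes> (\<one> \<ominus> e) = \<one> \<ominus> e"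
    using assms idempotent_elem_compl unfolding idempotent_elem_def by auto
  then have "peirce_glue e (e \<otimes> x) ((\<one> \<ominus> e) \<otimes> x) = peirce_glue e x x"
    using assms by (simp add: peirce_glue_def m_assoc[symmetric])
  then show ?thesis
    using peirce_glue_same \<open>e \<in> carrier R\<close> assms by simp
qed

text \<open>Of the four products, the two mixed ones vanish by orthogonality; in the other two the
  repeated central idempotent collapses to a single factor.\<close>

lemma peirce_glue_mult:
  assumes "idempotent_elem R e" "central_elem R e"
    and "a \<in> carrier R" "b \<in> carrier R" "c \<in> carrier R" "d \<in> carrier R"
  shows "peirce_glue e a b \<otimes> peirce_glue e c d = peirce_glue e (a \<otimes> c) (b \<otimes> d)"
proof -
  have e: "e \<in> carrier R" using assms by (simp add: idempotent_elem_def)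
  let ?f = "\<one> \<ominus> e"
  have f: "?f \<in> carrier R" using e by simp
  have "(e \<otimes> a) \<otimes> (?f \<otimes> d) = \<zero>" "(?f \<otimes> b) \<otimes> (e \<otimes> c) = \<zero>"
    using assms e f mult_compl_eq_zero central_elem_compl
    by (auto intro!: mult_central_orthogonal)
  moreover have "(e \<otimes> a) \<otimes> (e \<otimes> c) = e \<otimes> (a \<otimes> c)" "(?f \<otimes> b) \<otimes> (?f \<otimes> d) = ?f \<otimes> (b \<otimes> d)"
    using assms idempotent_elem_compl central_elem_compl
    by (auto intro!: mult_central_idempotent)
  ultimately show ?thesis
    using assms(3-6) e f by (simp add: peirce_glue_def l_distr r_distr)
qed

lemma peirce_glue_pow:
  assumes "idempotent_elem R e" "central_elem R e" "a \<in> carrier R" "b \<in> carrier R"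
  shows "peirce_glue e a b [^] (k::nat) = peirce_glue e (a [^] k) (b [^] k)"
  \<comment> \<open>The exponent 0 requires that glueing one with one gives one.\<close>
  using assms peirce_glue_same[of e \<one>]
  by (induction k) (auto simp: peirce_glue_mult idempotent_elem_def)

lemma idempotent_elem_peirce_glue:
  assumes "idempotent_elem R e" "central_elem R e" "idempotent_elem R f" "idempotent_elem R g"
  shows "idempotent_elem R (peirce_glue e f g)"
  using assms peirce_glue_mult[of e f g f g] peirce_glue_closed
  by (auto simp: idempotent_elem_def)

lemma nilpotent_elem_peirce_glue:
  assumes "idempotent_elem R e" "central_elem R e" "nilpotent_elem R m" "nilpotent_elem R n"
  shows "nilpotent_elem R (peirce_glue e m n)"
proof -
  from assms(3,4) obtain k l :: nat where
    mn: "m \<in> carrier R" "n \<in> carrier R" and k: "k \<ge> 1" "m [^] k = \<zero>" and l: "n [^] l = \<zero>"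
    unfolding nilpotent_elem_def by auto
  have e: "e \<in> carrier R" using assms(1) by (simp add: idempotent_elem_def)
  \<comment> \<open>The exponent \<open>k + l\<close> dominates both \<open>k\<close> and
    \<open>l\<close>, so both components vanish at once; it is positive because \<open>k\<close>
    is.\<close>
  have "peirce_glue e m n [^] (k + l) = peirce_glue e \<zero> \<zero>"
    using peirce_glue_pow[OF assms(1,2) mn] nat_pow_eq_zero_mono[OF mn(1) k(2)]
      nat_pow_eq_zero_mono[OF mn(2) l] by simp
  then have "peirce_glue e m n [^] (k + l) = \<zero>"
    using peirce_glue_same e by simp
  then show ?thesis
    using k(1) peirce_glue_closed e mn unfolding nilpotent_elem_def
    by (auto intro!: exI[of _ "k + l"])
qed

section \<open>Glueing decompositions with a common sign\<close>

lemma nil_clean_ideal_imp_minus: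
  assumes "nil_clean_ideal I R" "x \<in> I"
  obtains f m where "idempotent_elem R f" "nilpotent_elem R m" "x = \<ominus> f \<oplus> m"
proof -
  interpret I: ideal I R using assms(1) by (simp add: nil_clean_ideal_def)
  have x: "x \<in> carrier R" using assms(2) I.Icarr by auto
  \<comment> \<open>Decomposing the negative of \<open>x\<close> and negating back puts the minus
    sign on the idempotent, while the nilpotent part stays nilpotent.\<close>
  have "\<ominus> x \<in> I" using assms(2) by simp
  then obtain f m where fm: "idempotent_elem R f" "nilpotent_elem R m" "\<ominus> x = f \<oplus> m"
    using assms(1) unfolding nil_clean_ideal_def by blast
  have "f \<in> carrier R" "m \<in> carrier R"
    using fm by (auto simp: idempotent_elem_def nilpotent_elem_def)
  then have "x = \<ominus> f \<oplus> \<ominus> m"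
    using fm(3) x by (metis minus_minus minus_add)
  then show thesis
    using that fm nilpotent_elem_uminus by blast
qed

lemma weak_nil_clean_ring_if_peirce:
  assumes e: "idempotent_elem R e" "central_elem R e"
    and nil: "nil_clean_ideal (Idl {e}) R" and weak: "weak_nil_clean_ideal (Idl {\<one> \<ominus> e}) R"
  shows "weak_nil_clean_ring R"
  unfolding weak_nil_clean_ring_def
proof (intro conjI ballI)
  show "ring R" by (rule ring_axioms)
  fix x assume x: "x \<in> carrier R"
  have eR: "e \<in> carrier R" using e by (simp add: idempotent_elem_def)
  have ex: "e \<otimes> x \<in> Idl {e}" and fx: "(\<one> \<ominus> e) \<otimes> x \<in> Idl {\<one> \<ominus> e}"
    using genideal_self' genideal_ideal[of "{_}"] eR x by (simp_all add: ideal.I_r_closed)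
  from weak fx obtain g n where g: "idempotent_elem R g" and n: "nilpotent_elem R n"
    and gn: "(\<one> \<ominus> e) \<otimes> x = g \<oplus> n \<or> (\<one> \<ominus> e) \<otimes> x = \<ominus> g \<oplus> n"
    unfolding weak_nil_clean_ideal_def by blast
  have gR: "g \<in> carrier R" and nR: "n \<in> carrier R"
    using g n by (auto simp: idempotent_elem_def nilpotent_elem_def)
  \<comment> \<open>The weak side dictates the sign; the component in the nil clean ideal is then
    decomposed with that same sign.\<close>
  from gn show "\<exists>n f. nilpotent_elem R n \<and> idempotent_elem R f \<and> (x = n \<oplus> f \<or> x = n \<ominus> f)"
  proof
    assume *: "(\<one> \<ominus> e) \<otimes> x = g \<oplus> n"
    from nil ex obtain f m where f: "idempotent_elem R f" and m: "nilpotent_elem R m"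
      and fm: "e \<otimes> x = f \<oplus> m"
      unfolding nil_clean_ideal_def by blast
    have R: "f \<in> carrier R" "m \<in> carrier R"
      using f m by (auto simp: idempotent_elem_def nilpotent_elem_def)
    have "x = peirce_glue e (f \<oplus> m) (g \<oplus> n)"
      using peirce_glue_components[OF e(1) x] * fm by simp
    also have "\<dots> = peirce_glue e m n \<oplus> peirce_glue e f g"
      using R gR nR eR by (simp add: peirce_glue_add peirce_glue_closed a_comm)
    finally show ?thesis
      using idempotent_elem_peirce_glue[OF e f g] nilpotent_elem_peirce_glue[OF e m n] by blast
  next
    assume *: "(\<one> \<ominus> e) \<otimes> x = \<ominus> g \<oplus> n"
    from nil ex obtain f m where f: "idempotent_elem R f" and m: "nilpotent_elem R m"
      and fm: "e \<otimes> x = \<ominus> f \<oplus> m"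
      by (rule nil_clean_ideal_imp_minus)
    have R: "f \<in> carrier R" "m \<in> carrier R"
      using f m by (auto simp: idempotent_elem_def nilpotent_elem_def)
    have "x = peirce_glue e (\<ominus> f \<oplus> m) (\<ominus> g \<oplus> n)"
      using peirce_glue_components[OF e(1) x] * fm by simp
    \<comment> \<open>As both idempotents carry a minus sign, it can be pulled out of the glued
      idempotent.\<close>
    also have "\<dots> = peirce_glue e m n \<ominus> peirce_glue e f g"
      using R gR nR eR
      by (simp add: peirce_glue_add peirce_glue_uminus peirce_glue_closed a_comm minus_eq)
    finally show ?thesis
      using idempotent_elem_peirce_glue[OF e f g] nilpotent_elem_peirce_glue[OF e m n] by blast
  qed
qed

section \<open>The whole ring and the zero ideal\<close>

lemma weak_nil_clean_ideal_carrier: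
  assumes "weak_nil_clean_ring R"
  shows "weak_nil_clean_ideal (carrier R) R"
  unfolding weak_nil_clean_ideal_def
proof (intro conjI ballI)
  show "ideal (carrier R) R" by (rule oneideal)
  fix x assume "x \<in> carrier R"
  then obtain n e where ne: "nilpotent_elem R n" "idempotent_elem R e" "x = n \<oplus> e \<or> x = n \<ominus> e"
    using assms unfolding weak_nil_clean_ring_def by blast
  then have "n \<in> carrier R" "e \<in> carrier R"
    by (auto simp: idempotent_elem_def nilpotent_elem_def)
  then have "x = e \<oplus> n \<or> x = \<ominus> e \<oplus> n"
    using ne(3) by (auto simp: minus_eq a_comm)
  then show "\<exists>e n. idempotent_elem R e \<and> nilpotent_elem R n \<and> (x = e \<oplus> n \<or> x = \<ominus> e \<oplus> n)"
    using ne by blast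
qed

lemma nil_clean_ideal_zero: "nil_clean_ideal {\<zero>} R"
  using nilpotent_elem_zero unfolding nil_clean_ideal_def
  by (auto simp: zeroideal idempotent_elem_def intro!: exI[of _ \<zero>])

lemma nil_clean_ideal_imp_weak:
  assumes "nil_clean_ideal I R"
  shows "weak_nil_clean_ideal I R"
  using assms unfolding nil_clean_ideal_def weak_nil_clean_ideal_def by blast

end

theorem theorem2p11:
  fixes R :: "('a, 'b) ring_scheme" (structure)
  assumes "ring R"
  shows "weak_nil_clean_ring R \<longleftrightarrow>
    (\<exists>e. idempotent_elem R e \<and> central_elem R e \<and>
         weak_nil_clean_ideal (Idl\<^bsub>R\<^esub> {e}) R \<and>
         weak_nil_clean_ideal (Idl\<^bsub>R\<^esub> {\<one>\<^bsub>R\<^esub> \<ominus>\<^bsub>R\<^esub> e}) R \<and>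
         (nil_clean_ideal (Idl\<^bsub>R\<^esub> {e}) R \<or> nil_clean_ideal (Idl\<^bsub>R\<^esub> {\<one>\<^bsub>R\<^esub> \<ominus>\<^bsub>R\<^esub> e}) R))"
    (is "?L \<longleftrightarrow> (\<exists>e. ?P e)")
proof
  interpret ring R by fact
  assume ?L
  \<comment> \<open>For \<open>e = 0\<close> the two generated ideals are the zero ideal, which is
    nil clean, and \<open>R\<close> itself, which inherits the assumption.\<close>
  have "idempotent_elem R \<zero>" "central_elem R \<zero>"
    by (auto simp: idempotent_elem_def central_elem_def)
  moreover have "nil_clean_ideal (Idl {\<zero>}) R"
    using nil_clean_ideal_zero by (simp add: genideal_zero)
  moreover have "weak_nil_clean_ideal (Idl {\<one> \<ominus> \<zero>}) R"
    using weak_nil_clean_ideal_carrier[OF \<open>?L\<close>] by (simp add: genideal_one minus_eq)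
  ultimately have "?P \<zero>"
    using nil_clean_ideal_imp_weak by blast
  then show "\<exists>e. ?P e" by blast
next
  interpret ring R by fact
  assume "\<exists>e. ?P e"
  then obtain e where e: "?P e" by blast
  then have eR: "e \<in> carrier R" by (simp add: idempotent_elem_def)
  \<comment> \<open>The instance at \<open>1 - e\<close> handles the case where the ideal of
    \<open>1 - e\<close> is the nil clean one; its complement is again \<open>e\<close> by
    \<open>compl_compl\<close>.\<close>
  from e show ?L
    using weak_nil_clean_ring_if_peirce[of e] weak_nil_clean_ring_if_peirce[of "\<one> \<ominus> e"]
      idempotent_elem_compl[of e] central_elem_compl[of e] compl_compl[OF eR]
    by auto
qed

end
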